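(* Let $q$ be a prime power (the characteristic of $\mathbb{F}_q$ is arbitrary), let $m>0$, and for each $\alpha\in\mathbb{F}_q^\times$ fix a set $\Omega_\alpha$ of orbit representatives as in the context. Then each $\mathrm{O}_2^{+}(\mathbb{F}_q)$-orbit on $V^m$ contains one and only one element of the following type: (0) $(0,\ldots,0)$; (a) $\left(0^{(r)},\begin{pmatrix}1\\0\end{pmatrix},u_1,\ldots,u_t\right)$, where $r,t\ge0$, $r+1+t=m$, and $u_1,\ldots,u_t\in V$; (b) $\left(0^{(r)},\begin{pmatrix}1\\ \alpha\end{pmatrix},\begin{pmatrix}\beta_1\\ \alpha\beta_1\end{pmatrix},\ldots,\begin{pmatrix}\beta_s\\ \alpha\beta_s\end{pmatrix}\right)$, where $r,s\ge0$, $r+1+s=m$, $\alpha\in\mathbb{F}_q^\times$, $\beta_1,\ldots,\beta_s\in\mathbb{F}_q$; (c) $\left(0^{(r)},\begin{pmatrix}1\\ \alpha\end{pmatrix},\begin{pmatrix}\beta_1\\ \alpha\beta_1\end{pmatrix},\ldots,\begin{pmatrix}\beta_s\\ \alpha\beta_s\end{pmatrix},w,u_1,\ldots,u_t\right)$, where $r,s,t\ge0$, $r+s+t+2=m$, $\alpha\in\mathbb{F}_q^\times$, $\beta_1,\ldots,\beta_s\in\mathbb{F}_q$, $w\in\Omega_\alpha$, and $u_1,\ldots,u_t\in V$.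
   Context: $V=\mathbb{F}_q^2$ (column vectors). For $\alpha\in\mathbb{F}_q^\times$ put $\sigma_\alpha=\begin{pmatrix}0&\alpha\\ \alpha^{-1}&0\end{pmatrix}$, $\tau_\alpha=\begin{pmatrix}\alpha&0\\0&\alpha^{-1}\end{pmatrix}$; then $\mathrm{O}_2^{+}(\mathbb{F}_q)=\{\sigma_\alpha,\tau_\alpha\mid\alpha\in\mathbb{F}_q^\times\}$, a subgroup of $\mathrm{GL}_2(\mathbb{F}_q)$. It acts diagonally on $V^m$: $g\cdot(v_1,\ldots,v_m)=(gv_1,\ldots,gv_m)$. For $v\in V$ and $r\ge0$, $v^{(r)}$ denotes $(v,\ldots,v)\in V^r$ ($r$ copies). For $\alpha\in\mathbb{F}_q^\times$, let $S_\alpha=\left\{\begin{pmatrix}\beta\\ \gamma\end{pmatrix}\;\middle|\;\beta,\gamma\in\mathbb{F}_q,\ \alpha\beta\ne\gamma\right\}=V\setminus\mathbb{F}_q\begin{pmatrix}1\\ \alpha\end{pmatrix}$. The two-element group $\{\tau_1,\sigma_{\alpha^{-1}}\}$ acts on $S_\alpha$, and $\Omega_\alpha$ denotes any (fixed) set of representatives of the orbits of this action on $S_\alpha$ (exactly one element from each orbit). *)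

theory Defs
  imports "HOL-Analysis.Cartesian_Space" "HOL-Algebra.Group_Action"
begin

text \<open>
  The field \<open>F\<^sub>q\<close> is a type \<open>'a :: {field, finite}\<close>, and \<open>V\<close> is the type \<open>'a ^ 2\<close>.
  Since \<open>m\<close> is a number, \<open>V^m\<close> is the set of lists of length \<open>m\<close> over \<open>V\<close>, and \<open>v\<^sup>(\<^sup>r\<^sup>)\<close> is
  \<open>replicate r v\<close>.
  The argument of \<open>vector\<close> lists the rows of a matrix.
\<close>

definition sigma :: "'a::field \<Rightarrow> 'a ^ 2 ^ 2"
  where "sigma \<alpha> = vector [vector [0, \<alpha>], vector [inverse \<alpha>, 0]]"

definition tau :: "'a::field \<Rightarrow> 'a ^ 2 ^ 2"
  where "tau \<alpha> = vector [vector [\<alpha>, 0], vector [0, inverse \<alpha>]]"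

definition GL2 :: "('a::field ^ 2 ^ 2) monoid"
  where "GL2 = \<lparr>carrier = {A. invertible A}, mult = (**), one = mat 1\<rparr>"

definition O2plus_set :: "('a::field ^ 2 ^ 2) set"
  where "O2plus_set = {sigma \<alpha> | \<alpha>. \<alpha> \<noteq> 0} \<union> {tau \<alpha> | \<alpha>. \<alpha> \<noteq> 0}"

definition O2plus :: "('a::field ^ 2 ^ 2) monoid"
  where "O2plus = GL2\<lparr>carrier := O2plus_set\<rparr>"

definition tuples :: "nat \<Rightarrow> ('a ^ 2) list set"
  where "tuples m = {vs. length vs = m}"

text \<open>The restrictions to the set acted upon are what \<^locale>\<open>group_action\<close> requires.\<close>

definition diag_act :: "nat \<Rightarrow> 'a::field ^ 2 ^ 2 \<Rightarrow> ('a ^ 2) list \<Rightarrow> ('a ^ 2) list"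
  where "diag_act m g = (\<lambda>vs\<in>tuples m. map (\<lambda>v. g *v v) vs)"

definition S :: "'a::field \<Rightarrow> ('a ^ 2) set"
  where "S \<alpha> = {vector [\<beta>, \<gamma>] | \<beta> \<gamma>. \<alpha> * \<beta> \<noteq> \<gamma>}"

definition S_group :: "'a::field \<Rightarrow> ('a ^ 2 ^ 2) monoid"
  where "S_group \<alpha> = GL2\<lparr>carrier := {tau 1, sigma (inverse \<alpha>)}\<rparr>"

definition S_act :: "'a::field \<Rightarrow> 'a ^ 2 ^ 2 \<Rightarrow> 'a ^ 2 \<Rightarrow> 'a ^ 2"
  where "S_act \<alpha> g = (\<lambda>v\<in>S \<alpha>. g *v v)"

definition orbit_representatives ::
    "('g, 'c) monoid_scheme \<Rightarrow> 'b set \<Rightarrow> ('g \<Rightarrow> 'b \<Rightarrow> 'b) \<Rightarrow> 'b set \<Rightarrow> bool"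
  where "orbit_representatives G E \<phi> R \<longleftrightarrow>
    R \<subseteq> E \<and> (\<forall>X\<in>orbits G E \<phi>. \<exists>!x. x \<in> X \<and> x \<in> R)"

definition type_0 :: "nat \<Rightarrow> ('a::field ^ 2) list set"
  where "type_0 m = {replicate m 0}"

definition type_a :: "nat \<Rightarrow> ('a::field ^ 2) list set"
  where "type_a m =
    {replicate r 0 @ [vector [1, 0]] @ us | r t us.
       r + 1 + t = m \<and> length us = t}"

definition type_b :: "nat \<Rightarrow> ('a::field ^ 2) list set"
  where "type_b m =
    {replicate r 0 @ [vector [1, \<alpha>]] @ map (\<lambda>\<beta>. vector [\<beta>, \<alpha> * \<beta>]) \<beta>s | r s \<alpha> \<beta>s.
       r + 1 + s = m \<and> \<alpha> \<noteq> 0 \<and> length \<beta>s = s}"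

definition type_c :: "('a \<Rightarrow> ('a ^ 2) set) \<Rightarrow> nat \<Rightarrow> ('a::field ^ 2) list set"
  where "type_c \<Omega> m =
    {replicate r 0 @ [vector [1, \<alpha>]] @ map (\<lambda>\<beta>. vector [\<beta>, \<alpha> * \<beta>]) \<beta>s @ [w] @ us |
       r s t \<alpha> \<beta>s w us.
       r + s + t + 2 = m \<and> \<alpha> \<noteq> 0 \<and> length \<beta>s = s \<and> w \<in> \<Omega> \<alpha> \<and> length us = t}"


lemma mat2_eq_iff:
  "A = B \<longleftrightarrow> A$1$1 = B$1$1 \<and> A$1$2 = B$1$2 \<and> A$2$1 = B$2$1 \<and> A$2$2 = (B$2$2 :: 'a)"
  for A B :: "'a ^ 2 ^ 2"
  by (auto simp: vec_eq_iff forall_2)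

lemma sigma_tau_nth [simp]:
  "sigma \<alpha> $ 1 $ 1 = 0" "sigma \<alpha> $ 1 $ 2 = \<alpha>" "sigma \<alpha> $ 2 $ 1 = inverse \<alpha>" "sigma \<alpha> $ 2 $ 2 = 0"
  "tau \<alpha> $ 1 $ 1 = \<alpha>" "tau \<alpha> $ 1 $ 2 = 0" "tau \<alpha> $ 2 $ 1 = 0" "tau \<alpha> $ 2 $ 2 = inverse \<alpha>"
  by (simp_all add: sigma_def tau_def)

lemma sigma_tau_mult:
  "sigma \<alpha> ** sigma \<beta> = tau (\<alpha> * inverse \<beta>)"
  "sigma \<alpha> ** tau \<beta> = sigma (\<alpha> * inverse \<beta>)"
  "tau \<alpha> ** sigma \<beta> = sigma (\<alpha> * \<beta>)"
  "tau \<alpha> ** tau \<beta> = tau (\<alpha> * \<beta>)"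
  by (simp_all add: mat2_eq_iff matrix_matrix_mult_def sum_2)

lemma tau_1: "tau 1 = mat 1"
  by (simp add: mat2_eq_iff mat_def)

lemma sigma_tau_inverse:
  assumes "\<alpha> \<noteq> 0"
  shows "sigma \<alpha> ** sigma \<alpha> = mat 1" "tau \<alpha> ** tau (inverse \<alpha>) = mat 1"
    "tau (inverse \<alpha>) ** tau \<alpha> = mat 1"
  using assms by (simp_all add: sigma_tau_mult tau_1)

lemma sigma_tau_invertible:
  assumes "\<alpha> \<noteq> 0"
  shows "invertible (sigma \<alpha>)" "invertible (tau \<alpha>)"
  using sigma_tau_inverse[OF assms] unfolding invertible_def by blast+

lemma group_GL2: "group (GL2 :: ('a::field ^ 2 ^ 2) monoid)"
proof (rule groupI)
  fix A :: "'a ^ 2 ^ 2"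
  assume "A \<in> carrier GL2"
  then show "\<exists>B\<in>carrier GL2. B \<otimes>\<^bsub>GL2\<^esub> A = \<one>\<^bsub>GL2\<^esub>"
    by (auto simp: GL2_def invertible_def)
qed (auto simp: GL2_def invertible_mult matrix_mul_assoc, auto simp: invertible_def)

lemma GL2_inv_eqI:
  assumes "A ** B = mat 1" "B ** A = mat 1"
  shows "inv\<^bsub>GL2\<^esub> A = (B :: 'a::field ^ 2 ^ 2)"
proof -
  interpret group "GL2 :: ('a ^ 2 ^ 2) monoid" by (rule group_GL2)
  show ?thesis
    by (rule inv_equality) (use assms in \<open>auto simp: GL2_def invertible_def\<close>)
qed

lemma subgroup_O2plus: "subgroup O2plus_set (GL2 :: ('a::field ^ 2 ^ 2) monoid)"
proof -
  interpret group "GL2 :: ('a ^ 2 ^ 2) monoid" by (rule group_GL2)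
  have mem: "sigma \<alpha> \<in> O2plus_set" "tau \<alpha> \<in> O2plus_set" if "\<alpha> \<noteq> 0" for \<alpha> :: 'a
    using that unfolding O2plus_set_def by blast+
  have E: thesis
    if "A \<in> O2plus_set" and "\<And>\<alpha>. \<alpha> \<noteq> 0 \<Longrightarrow> A = sigma \<alpha> \<Longrightarrow> thesis"
      and "\<And>\<alpha>. \<alpha> \<noteq> 0 \<Longrightarrow> A = tau \<alpha> \<Longrightarrow> thesis" for A :: "'a ^ 2 ^ 2" and thesis
    using that unfolding O2plus_set_def by blast
  show ?thesis
  proof (rule subgroupI)
    show "O2plus_set \<subseteq> carrier GL2"
      by (auto simp: O2plus_set_def GL2_def sigma_tau_invertible)
    show "O2plus_set \<noteq> ({} :: ('a ^ 2 ^ 2) set)"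
      using mem(1)[of 1] by auto
    show "inv\<^bsub>GL2\<^esub> A \<in> O2plus_set" if "A \<in> O2plus_set" for A :: "'a ^ 2 ^ 2"
      using that
    proof (rule E)
      fix \<alpha> :: 'a assume nz: "\<alpha> \<noteq> 0" and A: "A = sigma \<alpha>"
      have "inv\<^bsub>GL2\<^esub> A = sigma \<alpha>"
        unfolding A by (rule GL2_inv_eqI) (rule sigma_tau_inverse[OF nz])+
      then show ?thesis using mem(1)[OF nz] by simp
    next
      fix \<alpha> :: 'a assume nz: "\<alpha> \<noteq> 0" and A: "A = tau \<alpha>"
      have "inv\<^bsub>GL2\<^esub> A = tau (inverse \<alpha>)"
        unfolding A by (rule GL2_inv_eqI) (rule sigma_tau_inverse[OF nz])+
      then show ?thesis using mem(2)[of "inverse \<alpha>"] nz by simp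
    qed
    show "A \<otimes>\<^bsub>GL2\<^esub> B \<in> O2plus_set" if "A \<in> O2plus_set" "B \<in> O2plus_set" for A B :: "'a ^ 2 ^ 2"
      by (rule E[OF that(1)]; rule E[OF that(2)]) (simp_all add: GL2_def sigma_tau_mult mem)
  qed
qed

lemma subgroup_S_group:
  assumes "\<alpha> \<noteq> 0"
  shows "subgroup {tau 1, sigma (inverse \<alpha>)} (GL2 :: ('a::field ^ 2 ^ 2) monoid)"
proof -
  interpret group "GL2 :: ('a ^ 2 ^ 2) monoid" by (rule group_GL2)
  have nz: "inverse \<alpha> \<noteq> 0" using assms by simp
  have "inv\<^bsub>GL2\<^esub> (tau 1 :: 'a ^ 2 ^ 2) = tau 1" by (simp add: GL2_inv_eqI tau_1)
  moreover have "inv\<^bsub>GL2\<^esub> (sigma (inverse \<alpha>)) = sigma (inverse \<alpha>)"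
    using sigma_tau_inverse(1)[OF nz] by (rule GL2_inv_eqI) (rule sigma_tau_inverse(1)[OF nz])
  ultimately show ?thesis
    using sigma_tau_invertible[OF nz] sigma_tau_invertible(2)[of "1::'a"] assms
    by (intro subgroupI) (auto simp: GL2_def sigma_tau_mult)
qed

lemma group_O2plus: "group O2plus"
  unfolding O2plus_def by (rule subgroup.subgroup_is_group[OF subgroup_O2plus group_GL2])

lemma group_S_group: "\<alpha> \<noteq> 0 \<Longrightarrow> group (S_group \<alpha>)"
  unfolding S_group_def by (rule subgroup.subgroup_is_group[OF subgroup_S_group group_GL2])

lemma group_action_restrictI:
  fixes G (structure)
  assumes "group G"
    and closed: "\<And>g x. g \<in> carrier G \<Longrightarrow> x \<in> E \<Longrightarrow> \<psi> g x \<in> E"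
    and one: "\<And>x. x \<in> E \<Longrightarrow> \<psi> \<one>\<^bsub>G\<^esub> x = x"
    and mult: "\<And>g h x. g \<in> carrier G \<Longrightarrow> h \<in> carrier G \<Longrightarrow> x \<in> E \<Longrightarrow>
      \<psi> (g \<otimes>\<^bsub>G\<^esub> h) x = \<psi> g (\<psi> h x)"
  shows "group_action G E (\<lambda>g. \<lambda>x\<in>E. \<psi> g x)"
proof -
  interpret group G by fact
  have bij: "(\<lambda>x\<in>E. \<psi> g x) \<in> Bij E" if g: "g \<in> carrier G" for g
  proof -
    have "bij_betw (\<psi> g) E E"
      by (rule bij_betwI[where g = "\<psi> (inv g)"])
        (use g closed mult[symmetric] one in auto)
    then show ?thesis by (simp add: Bij_def cong: bij_betw_cong)
  qed
  have "(\<lambda>g. \<lambda>x\<in>E. \<psi> g x) \<in> hom G (BijGroup E)"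
    by (rule homI)
      (auto simp: BijGroup_def bij compose_def fun_eq_iff mult closed)
  then show ?thesis
    by (simp add: group_action_def group_hom_def group_hom_axioms_def group_BijGroup is_group)
qed

lemma group_action_diag: "group_action O2plus (tuples m) (diag_act m)"
  unfolding diag_act_def[abs_def]
  by (rule group_action_restrictI[OF group_O2plus])
    (auto simp: tuples_def O2plus_def GL2_def matrix_vector_mul_assoc intro!: map_idI)

lemma S_nth: "v \<in> S \<alpha> \<longleftrightarrow> \<alpha> * v $ 1 \<noteq> v $ 2"
  by (auto simp: S_def vec_eq_iff forall_2)

lemma S_eq_Diff: "S \<alpha> = UNIV - range (\<lambda>c. c *s vector [1, \<alpha>])"
  by (auto simp: S_nth image_iff vec_eq_iff forall_2 mult.commute)

lemma group_action_S:
  assumes "\<alpha> \<noteq> 0"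
  shows "group_action (S_group \<alpha>) (S \<alpha>) (S_act \<alpha>)"
  unfolding S_act_def[abs_def]
proof (rule group_action_restrictI[OF group_S_group[OF assms]])
  fix g v assume "g \<in> carrier (S_group \<alpha>)" "v \<in> S \<alpha>"
  with assms show "g *v v \<in> S \<alpha>"
    by (auto simp: S_group_def GL2_def S_nth matrix_vector_mult_def sum_2 field_simps)
qed (simp_all add: S_group_def GL2_def matrix_vector_mul_assoc)

end

theory Submission
  imports Defs
begin

text \<open>
  Move the first nonzero entry to the form \<open>(1, \<alpha>)\<close>. If \<open>\<alpha> = 0\<close>, its stabiliser is trivial, and
  the remaining entries are arbitrary. If \<open>\<alpha> \<noteq> 0\<close>, its stabiliser is \<open>{\<tau>\<^sub>1, \<sigma>\<^bsub>1/\<alpha>\<^esub>}\<close>, which fixes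
  exactly the vectors outside \<open>S \<alpha>\<close>; so the first entry in \<open>S \<alpha>\<close> can be moved into \<open>\<Omega> \<alpha>\<close>, and
  this determines the group element. Membership in the four types can be read off a tuple from
  left to right, which allows induction on the tuple.
\<close>

section \<open>Coordinates and the action of single matrices on vectors\<close>

lemma vec2_eq_iff: "v = w \<longleftrightarrow> v $ 1 = w $ 1 \<and> v $ 2 = w $ 2" for v w :: "'a ^ 2"
  by (auto simp: vec_eq_iff forall_2)

lemma sigma_tau_vector_nth [simp]:
  "(sigma a *v v) $ 1 = a * v $ 2" "(sigma a *v v) $ 2 = inverse a * v $ 1"
  "(tau a *v v) $ 1 = a * v $ 1" "(tau a *v v) $ 2 = inverse a * v $ 2"
  by (simp_all add: matrix_vector_mult_def sum_2)

lemma O2plus_setE: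
  assumes "g \<in> O2plus_set"
  obtains a where "a \<noteq> 0" "g = sigma a" | a where "a \<noteq> 0" "g = tau a"
  using assms by (auto simp: O2plus_set_def)

lemma O2plus_set_mult: "g \<in> O2plus_set \<Longrightarrow> h \<in> O2plus_set \<Longrightarrow> g ** h \<in> O2plus_set"
  using subgroup.m_closed[OF subgroup_O2plus] by (simp add: GL2_def)

lemma O2plus_set_mult_vec_eq_0_iff:
  "g \<in> O2plus_set \<Longrightarrow> g *v v = 0 \<longleftrightarrow> v = 0"
  by (elim O2plus_setE) (auto simp: vec2_eq_iff[where w = 0])

lemma tau_1_mult [simp]: "tau 1 *v v = v"
  by (simp add: vec2_eq_iff)

section \<open>The two-element group and the line it fixes pointwise\<close>

lemma sigma_fixes_iff:
  assumes "\<alpha> \<noteq> 0"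
  shows "sigma (inverse \<alpha>) *v v = v \<longleftrightarrow> v \<notin> S \<alpha>"
  using assms by (auto simp: vec2_eq_iff S_nth field_simps)

definition stab :: "'a::field \<Rightarrow> ('a ^ 2 ^ 2) set"
  where "stab \<alpha> = {tau 1, sigma (inverse \<alpha>)}"

lemma stab_subset_O2plus_set: "\<alpha> \<noteq> 0 \<Longrightarrow> stab \<alpha> \<subseteq> O2plus_set"
  by (auto simp: stab_def O2plus_set_def)

text \<open>The complement of \<open>S \<alpha>\<close> is a line fixed pointwise by
  \<open>stab \<alpha>\<close>. Hence a left-to-right scan that branches on membership in
  \<open>S \<alpha>\<close> takes the same branches before and after applying
  \<open>h\<close>.\<close>

lemma stab_mem_S_iff:
  assumes "\<alpha> \<noteq> 0" "h \<in> stab \<alpha>"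
  shows "h *v v \<in> S \<alpha> \<longleftrightarrow> v \<in> S \<alpha>"
  using assms by (auto simp: stab_def S_nth field_simps)

lemma stab_fixes:
  assumes "\<alpha> \<noteq> 0" "h \<in> stab \<alpha>" "v \<notin> S \<alpha>"
  shows "h *v v = v"
  using assms sigma_fixes_iff by (auto simp: stab_def)

text \<open>The action on \<open>S \<alpha>\<close> is free, in every characteristic, because
  \<open>sigma (inverse \<alpha>)\<close> fixes no vector there. One fixed entry in
  \<open>S \<alpha>\<close> thus determines \<open>h\<close>.\<close>

lemma stab_eq_tau_1:
  assumes "\<alpha> \<noteq> 0" "h \<in> stab \<alpha>" "v \<in> S \<alpha>" "h *v v = v"
  shows "h = tau 1"
  using assms sigma_fixes_iff by (auto simp: stab_def)

section \<open>Normalising the first nonzero entry\<close>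

lemma to_first_coordinate_1:
  assumes "v \<noteq> 0"
  obtains g where "g \<in> O2plus_set" "(g *v v) $ 1 = 1"
proof (cases "v $ 1 = 0")
  case True
  then have "v $ 2 \<noteq> 0" using assms by (auto simp: vec2_eq_iff)
  \<comment> \<open>No \<open>tau\<close> changes a zero first coordinate, so a \<open>sigma\<close>
    brings the nonzero second coordinate to the front and scales it to 1.\<close>
  then show ?thesis
    by (intro that[of "sigma (inverse (v $ 2))"]) (auto simp: O2plus_set_def)
next
  case False
  then show ?thesis
    by (intro that[of "tau (inverse (v $ 1))"]) (auto simp: O2plus_set_def)
qed

text \<open>Every element of the group preserves the product of the two coordinates. A first
  coordinate 1 before and after therefore forces equal second coordinates, so it is enough to assume
  the former to land in the stabiliser of \<open>v\<close>.\<close>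

lemma stabilizer_first_coordinate_1:
  assumes "g \<in> O2plus_set" "v $ 1 = 1" "(g *v v) $ 1 = 1"
  shows "if v $ 2 = 0 then g = tau 1 else g \<in> stab (v $ 2)"
  using assms(1)
proof (cases rule: O2plus_setE)
  case (1 a)
  \<comment> \<open>This equation excludes \<open>v $ 2 = 0\<close> and otherwise gives
    \<open>a = inverse (v $ 2)\<close>.\<close>
  then have "a * v $ 2 = 1" using assms by simp
  then show ?thesis using 1 inverse_unique[of "v $ 2" a] by (auto simp: stab_def mult.commute)
next
  case (2 a)
  then show ?thesis using assms by (simp add: stab_def)
qed

section \<open>The four types as recursive predicates\<close>

text \<open>Covers what follows (1, \<alpha>) in types (b) and (c): the scan reaches the end of the
  list in (b) and stops at \<open>w\<close> in (c), leaving the later entries free.\<close>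

fun normal_tail :: "'a::field \<Rightarrow> ('a ^ 2) set \<Rightarrow> ('a ^ 2) list \<Rightarrow> bool"
  where "normal_tail \<alpha> R [] \<longleftrightarrow> True"
  | "normal_tail \<alpha> R (v # vs) \<longleftrightarrow> (if v \<in> S \<alpha> then v \<in> R else normal_tail \<alpha> R vs)"

text \<open>Running out of entries is type (0). The disjunct \<open>v $ 2 = 0\<close> is type (a),
  where the trivial stabiliser leaves no freedom to normalise the rest.\<close>

fun normal_form :: "('a::field \<Rightarrow> ('a ^ 2) set) \<Rightarrow> ('a ^ 2) list \<Rightarrow> bool"
  where "normal_form \<Omega> [] \<longleftrightarrow> True"
  | "normal_form \<Omega> (v # vs) \<longleftrightarrow>
      (if v = 0 then normal_form \<Omega> vs
       else v $ 1 = 1 \<and> (v $ 2 = 0 \<or> normal_tail (v $ 2) (\<Omega> (v $ 2)) vs))"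

lemma vector_1_neq_0 [simp]: "vector [1, x] \<noteq> (0 :: 'a::field ^ 2)"
  by (simp add: vec2_eq_iff)

lemma vector_line_notin_S [simp]: "vector [\<beta>, \<alpha> * \<beta>] \<notin> S \<alpha>"
  by (simp add: S_nth)

lemma normal_tail_line_append:
  "normal_tail \<alpha> R (map (\<lambda>\<beta>. vector [\<beta>, \<alpha> * \<beta>]) \<beta>s @ us) \<longleftrightarrow> normal_tail \<alpha> R us"
  by (induction \<beta>s) simp_all

lemma normal_tail_iff:
  assumes "R \<subseteq> S \<alpha>"
  shows "normal_tail \<alpha> R vs \<longleftrightarrow>
    (\<exists>\<beta>s. vs = map (\<lambda>\<beta>. vector [\<beta>, \<alpha> * \<beta>]) \<beta>s) \<or>
    (\<exists>\<beta>s w us. w \<in> R \<and> vs = map (\<lambda>\<beta>. vector [\<beta>, \<alpha> * \<beta>]) \<beta>s @ w # us)"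
    (is "_ \<longleftrightarrow> ?B vs \<or> ?C vs")
proof
  assume "normal_tail \<alpha> R vs"
  then show "?B vs \<or> ?C vs"
  proof (induction vs)
    case (Cons v vs)
    show ?case
    proof (cases "v \<in> S \<alpha>")
      case True
      then have "v \<in> R \<and> v # vs = map (\<lambda>\<beta>. vector [\<beta>, \<alpha> * \<beta>]) [] @ v # vs"
        using Cons.prems by simp
      then show ?thesis by blast
    next
      case False
      then have v: "v $ 2 = \<alpha> * v $ 1" by (simp add: S_nth)
      from False Cons have "?B vs \<or> ?C vs" by simp
      then show ?thesis
      proof
        assume "?B vs"
        then obtain \<beta>s where "vs = map (\<lambda>\<beta>. vector [\<beta>, \<alpha> * \<beta>]) \<beta>s" by blast
        then have "v # vs = map (\<lambda>\<beta>. vector [\<beta>, \<alpha> * \<beta>]) (v $ 1 # \<beta>s)"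
          using v by (simp add: vec2_eq_iff)
        then show ?thesis by (intro disjI1 exI)
      next
        assume "?C vs"
        then obtain \<beta>s w us
          where w: "w \<in> R" and "vs = map (\<lambda>\<beta>. vector [\<beta>, \<alpha> * \<beta>]) \<beta>s @ w # us" by blast
        then have "v # vs = map (\<lambda>\<beta>. vector [\<beta>, \<alpha> * \<beta>]) (v $ 1 # \<beta>s) @ w # us"
          using v by (simp add: vec2_eq_iff)
        with w show ?thesis by (intro disjI2 exI conjI)
      qed
    qed
  qed simp
next
  \<comment> \<open>Since \<open>R\<close> lies in \<open>S \<alpha>\<close>, the scan passes the
    line vectors and stops exactly at \<open>w\<close>.\<close>
  show "?B vs \<or> ?C vs \<Longrightarrow> normal_tail \<alpha> R vs"
    using assms normal_tail_line_append[where us = "[]"] by (auto simp: normal_tail_line_append)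
qed

lemma normal_form_replicate_append: "normal_form \<Omega> (replicate r 0 @ vs) \<longleftrightarrow> normal_form \<Omega> vs"
  by (induction r) simp_all

lemma types_iff_normal_form:
  fixes \<Omega> :: "'a::field \<Rightarrow> ('a ^ 2) set"
  assumes "\<And>\<alpha>. \<alpha> \<noteq> 0 \<Longrightarrow> \<Omega> \<alpha> \<subseteq> S \<alpha>"
  shows "vs \<in> type_0 m \<union> type_a m \<union> type_b m \<union> type_c \<Omega> m \<longleftrightarrow> length vs = m \<and> normal_form \<Omega> vs"
proof
  assume "vs \<in> type_0 m \<union> type_a m \<union> type_b m \<union> type_c \<Omega> m"
  then consider "vs \<in> type_0 m" | "vs \<in> type_a m" | "vs \<in> type_b m" | "vs \<in> type_c \<Omega> m"
    by blast
  then show "length vs = m \<and> normal_form \<Omega> vs"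
  proof cases
    case 1
    then show ?thesis
      using normal_form_replicate_append[of \<Omega> m "[]"] by (simp add: type_0_def)
  next
    case 2
    then show ?thesis
      by (auto simp: type_a_def normal_form_replicate_append)
  next
    case 3
    then show ?thesis
      using normal_tail_line_append[where us = "[]"]
      by (auto simp: type_b_def normal_form_replicate_append)
  next
    case 4
    then obtain r \<alpha> \<beta>s w us where
      "vs = replicate r 0 @ [vector [1, \<alpha>]] @ map (\<lambda>\<beta>. vector [\<beta>, \<alpha> * \<beta>]) \<beta>s @ [w] @ us"
      "r + length \<beta>s + length us + 2 = m" "\<alpha> \<noteq> 0" "w \<in> \<Omega> \<alpha>"
      unfolding type_c_def by blast
    moreover from this have "w \<in> S \<alpha>" using assms by blast
    ultimately show ?thesis
      by (simp add: normal_form_replicate_append normal_tail_line_append)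
  qed
next
  assume vs: "length vs = m \<and> normal_form \<Omega> vs"
  \<comment> \<open>The zero prefix is taken maximal, so that \<open>ws\<close>, if nonempty, starts
    with a nonzero vector.\<close>
  define r where "r = length (takeWhile ((=) 0) vs)"
  define ws where "ws = dropWhile ((=) 0) vs"
  have "takeWhile ((=) 0) vs = replicate r 0"
    unfolding r_def by (rule replicate_eqI) (auto dest: set_takeWhileD)
  then have split: "vs = replicate r 0 @ ws"
    unfolding ws_def using takeWhile_dropWhile_id[of "(=) 0" vs] by simp
  show "vs \<in> type_0 m \<union> type_a m \<union> type_b m \<union> type_c \<Omega> m"
  proof (cases ws)
    case Nil
    then show ?thesis using vs split by (simp add: type_0_def)
  next
    case (Cons v us)
    then have "v \<noteq> 0" unfolding ws_def by (auto simp: dropWhile_eq_Cons_conv)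
    then have "v $ 1 = 1" "v $ 2 = 0 \<or> normal_tail (v $ 2) (\<Omega> (v $ 2)) us"
      using vs by (simp_all add: split normal_form_replicate_append Cons)
    then obtain \<alpha> where v: "v = vector [1, \<alpha>]" "\<alpha> = 0 \<or> normal_tail \<alpha> (\<Omega> \<alpha>) us"
      using that[of "v $ 2"] by (simp add: vec2_eq_iff)
    have len: "r + 1 + length us = m" using vs by (auto simp: split Cons)
    show ?thesis
    proof (cases "\<alpha> = 0")
      case True
      then have "vs \<in> type_a m" using v len unfolding type_a_def split Cons by auto
      then show ?thesis by simp
    next
      case False
      from v(2) False consider
        \<beta>s where "us = map (\<lambda>\<beta>. vector [\<beta>, \<alpha> * \<beta>]) \<beta>s"
        | \<beta>s w us' where "w \<in> \<Omega> (\<alpha>)"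
          "us = map (\<lambda>\<beta>. vector [\<beta>, \<alpha> * \<beta>]) \<beta>s @ w # us'"
        using normal_tail_iff[OF assms[OF False]] by blast
      then show ?thesis
      proof cases
        case (1 \<beta>s)
        have "vs = replicate r 0 @ [vector [1, \<alpha>]] @ map (\<lambda>\<beta>. vector [\<beta>, \<alpha> * \<beta>]) \<beta>s"
          using split Cons v(1) 1 by simp
        moreover have "r + 1 + length \<beta>s = m" using len 1 by simp
        ultimately have "vs \<in> type_b m" using False unfolding type_b_def by blast
        then show ?thesis by simp
      next
        case (2 \<beta>s w us')
        have "vs = replicate r 0 @ [vector [1, \<alpha>]] @
            map (\<lambda>\<beta>. vector [\<beta>, \<alpha> * \<beta>]) \<beta>s @ [w] @ us'"
          using split Cons v(1) 2 by simp
        moreover have "r + length \<beta>s + length us' + 2 = m" using len 2 by simp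
        ultimately have "vs \<in> type_c \<Omega> m" using False 2(1) unfolding type_c_def by blast
        then show ?thesis by simp
      qed
    qed
  qed
qed

section \<open>Representatives on \<open>S \<alpha>\<close> and normal tails\<close>

lemma orbit_representatives_S:
  assumes "orbit_representatives (S_group \<alpha>) (S \<alpha>) (S_act \<alpha>) R"
  shows "R \<subseteq> S \<alpha>"
    and "v \<in> S \<alpha> \<Longrightarrow> \<exists>h\<in>stab \<alpha>. h *v v \<in> R"
    and "v \<in> R \<Longrightarrow> h \<in> stab \<alpha> \<Longrightarrow> h *v v \<in> R \<Longrightarrow> h *v v = v"
proof -
  show sub: "R \<subseteq> S \<alpha>" using assms by (simp add: orbit_representatives_def)
  have orb: "\<exists>!x. x \<in> (\<lambda>h. h *v v) ` stab \<alpha> \<and> x \<in> R" if "v \<in> S \<alpha>" for v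
  proof -
    have "orbit (S_group \<alpha>) (S_act \<alpha>) v = (\<lambda>h. h *v v) ` stab \<alpha>"
      using that by (simp add: orbit_def S_group_def S_act_def Setcompr_eq_image flip: stab_def)
    moreover have "orbit (S_group \<alpha>) (S_act \<alpha>) v \<in> orbits (S_group \<alpha>) (S \<alpha>) (S_act \<alpha>)"
      using that unfolding orbits_def by blast
    ultimately show ?thesis
      using assms unfolding orbit_representatives_def by metis
  qed
  show "\<exists>h\<in>stab \<alpha>. h *v v \<in> R" if "v \<in> S \<alpha>"
    using orb[OF that] by auto
  show "h *v v = v" if "v \<in> R" "h \<in> stab \<alpha>" "h *v v \<in> R"
  proof -
    \<comment> \<open>By \<open>tau 1\<close>, \<open>v\<close> lies in its own orbit; so
      \<open>v\<close> and \<open>h *v v\<close> are both the unique representative of that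
      orbit.\<close>
    have "v \<in> (\<lambda>h. h *v v) ` stab \<alpha>" by (simp add: stab_def)
    then show ?thesis using orb[of v] that sub by blast
  qed
qed

text \<open>Only the first entry in \<open>S \<alpha>\<close> constrains \<open>h\<close>. Entries
  before it stay outside \<open>S \<alpha>\<close>, and entries after it are unrestricted.\<close>

lemma normal_tail_exists:
  assumes "\<alpha> \<noteq> 0" "orbit_representatives (S_group \<alpha>) (S \<alpha>) (S_act \<alpha>) R"
  shows "\<exists>h\<in>stab \<alpha>. normal_tail \<alpha> R (map ((*v) h) vs)"
proof (induction vs)
  case Nil
  then show ?case by (auto simp: stab_def)
next
  case (Cons v vs)
  show ?case
  proof (cases "v \<in> S \<alpha>")
    case True
    then show ?thesis
      using orbit_representatives_S(2)[OF assms(2) True] stab_mem_S_iff[OF assms(1)] by auto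
  next
    case False
    then show ?thesis using Cons.IH stab_mem_S_iff[OF assms(1)] by auto
  qed
qed

text \<open>Entries before the first one in \<open>S \<alpha>\<close> are fixed by \<open>h\<close>.
  At that entry, uniqueness of representatives gives a fixed vector in \<open>S \<alpha>\<close>, so
  \<open>h\<close> is the identity on the whole rest.\<close>

lemma normal_tail_unique:
  assumes "\<alpha> \<noteq> 0" "orbit_representatives (S_group \<alpha>) (S \<alpha>) (S_act \<alpha>) R" "h \<in> stab \<alpha>"
    and "normal_tail \<alpha> R vs" "normal_tail \<alpha> R (map ((*v) h) vs)"
  shows "map ((*v) h) vs = vs"
  using assms(4,5)
proof (induction vs)
  case (Cons v vs)
  show ?case
  proof (cases "v \<in> S \<alpha>")
    case True
    then have "v \<in> R" "h *v v \<in> R"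
      using Cons.prems assms(1,3) by (simp_all add: stab_mem_S_iff)
    then have "h *v v = v" using orbit_representatives_S(3)[OF assms(2)] assms(3) by blast
    then have "h = tau 1" using stab_eq_tau_1[OF assms(1,3) True] by blast
    then show ?thesis by (simp add: map_idI)
  next
    case False
    then show ?thesis
      using Cons assms(1,3) by (simp add: stab_mem_S_iff stab_fixes)
  qed
qed simp

section \<open>Existence and uniqueness of normal forms of tuples\<close>

lemma normal_form_exists:
  assumes "\<And>\<alpha>. \<alpha> \<noteq> 0 \<Longrightarrow> orbit_representatives (S_group \<alpha>) (S \<alpha>) (S_act \<alpha>) (\<Omega> \<alpha>)"
  shows "\<exists>g\<in>O2plus_set. normal_form \<Omega> (map ((*v) g) vs)"
proof (induction vs)
  case Nil
  then show ?case by (intro bexI[of _ "tau 1"]) (auto simp: O2plus_set_def)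
next
  case (Cons v vs)
  show ?case
  proof (cases "v = 0")
    case True
    then show ?thesis using Cons.IH by simp
  next
    case False
    then obtain g where g: "g \<in> O2plus_set" "(g *v v) $ 1 = 1" by (rule to_first_coordinate_1)
    let ?v = "g *v v"
    show ?thesis
    proof (cases "?v $ 2 = 0")
      case True
      then show ?thesis using g False by (auto simp: O2plus_set_mult_vec_eq_0_iff)
    next
      case nz: False
      then obtain h where h: "h \<in> stab (?v $ 2)"
        "normal_tail (?v $ 2) (\<Omega> (?v $ 2)) (map ((*v) h) (map ((*v) g) vs))"
        using normal_tail_exists assms by blast
      \<comment> \<open>The normalised entry is (1, \<open>?v $ 2\<close>), which lies on the fixed
        line, so correcting the tail by \<open>h\<close> does not spoil it.\<close>
      have "h *v ?v = ?v" using nz h(1) g(2) by (intro stab_fixes) (auto simp: S_nth)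
      moreover have "map ((*v) (h ** g)) (v # vs) = map ((*v) h) (map ((*v) g) (v # vs))"
        by (simp add: matrix_vector_mul_assoc)
      ultimately have "normal_form \<Omega> (map ((*v) (h ** g)) (v # vs))"
        using g h(2) False by (simp add: O2plus_set_mult_vec_eq_0_iff del: map_map)
      moreover have "h ** g \<in> O2plus_set"
        using O2plus_set_mult g(1) h(1) stab_subset_O2plus_set[OF nz] by blast
      ultimately show ?thesis by blast
    qed
  qed
qed

text \<open>Leading zeros match because \<open>g\<close> is injective. At the first nonzero entry
  both tuples have first coordinate 1, so \<open>g\<close> stabilises that entry; it is then the
  identity or the tails agree by their own uniqueness.\<close>

lemma normal_form_unique:
  assumes "\<And>\<alpha>. \<alpha> \<noteq> 0 \<Longrightarrow> orbit_representatives (S_group \<alpha>) (S \<alpha>) (S_act \<alpha>) (\<Omega> \<alpha>)"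
    and "g \<in> O2plus_set" "normal_form \<Omega> vs" "normal_form \<Omega> (map ((*v) g) vs)"
  shows "map ((*v) g) vs = vs"
  using assms(3,4)
proof (induction vs)
  case (Cons v vs)
  show ?case
  proof (cases "v = 0")
    case True
    then show ?thesis using Cons by simp
  next
    case False
    then have v: "v $ 1 = 1" "(g *v v) $ 1 = 1"
      using Cons.prems assms(2) by (simp_all add: O2plus_set_mult_vec_eq_0_iff)
    note stabilizer = stabilizer_first_coordinate_1[OF assms(2) this]
    show ?thesis
    proof (cases "v $ 2 = 0")
      case True
      then show ?thesis using stabilizer by (simp add: map_idI)
    next
      case nz: False
      then have g: "g \<in> stab (v $ 2)" using stabilizer by simp
      then have gv: "g *v v = v" using nz v(1) by (intro stab_fixes) (auto simp: S_nth)
      then have "map ((*v) g) vs = vs"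
        using normal_tail_unique[OF nz assms(1)[OF nz] g] Cons.prems False nz by simp
      then show ?thesis using gv by simp
    qed
  qed
qed simp

theorem theorem2p4:
  fixes \<Omega> :: "'a::{field, finite} \<Rightarrow> ('a ^ 2) set" and m :: nat
  assumes "m > 0"
    and "\<And>\<alpha>. \<alpha> \<noteq> 0 \<Longrightarrow> orbit_representatives (S_group \<alpha>) (S \<alpha>) (S_act \<alpha>) (\<Omega> \<alpha>)"
  shows "\<forall>X \<in> orbits O2plus (tuples m) (diag_act m).
    \<exists>!vs. vs \<in> X \<and> vs \<in> type_0 m \<union> type_a m \<union> type_b m \<union> type_c \<Omega> m"
proof
  fix X :: "('a ^ 2) list set"
  assume X_orbit: "X \<in> orbits O2plus (tuples m) (diag_act m)"
  interpret group_action O2plus "tuples m :: ('a ^ 2) list set" "diag_act m"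
    by (rule group_action_diag)
  have orbit: "orbit O2plus (diag_act m) vs = {map ((*v) g) vs | g. g \<in> O2plus_set}"
    if "vs \<in> tuples m" for vs :: "('a ^ 2) list"
    using that by (simp add: orbit_def O2plus_def diag_act_def)
  note types = types_iff_normal_form[OF orbit_representatives_S(1)[OF assms(2)]]
  obtain xs where xs: "xs \<in> tuples m" "X = orbit O2plus (diag_act m) xs"
    using X_orbit by (auto simp: orbits_def)
  have len: "length vs = m" if "vs \<in> X" for vs
    using that xs by (auto simp: orbit tuples_def)
  show "\<exists>!vs. vs \<in> X \<and> vs \<in> type_0 m \<union> type_a m \<union> type_b m \<union> type_c \<Omega> m"
  proof (rule ex_ex1I)
    show "\<exists>vs. vs \<in> X \<and> vs \<in> type_0 m \<union> type_a m \<union> type_b m \<union> type_c \<Omega> m"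
      using normal_form_exists[of \<Omega> xs] assms(2) xs len types by (auto simp: orbit)
  next
    fix vs ws
    assume vs: "vs \<in> X \<and> vs \<in> type_0 m \<union> type_a m \<union> type_b m \<union> type_c \<Omega> m"
      and ws: "ws \<in> X \<and> ws \<in> type_0 m \<union> type_a m \<union> type_b m \<union> type_c \<Omega> m"
    have mem: "vs \<in> tuples m" "ws \<in> tuples m" using vs ws len by (auto simp: tuples_def)
    \<comment> \<open>Both tuples lie in the orbit of \<open>xs\<close>; symmetry and transitivity
      provide a group element carrying \<open>vs\<close> to \<open>ws\<close>.\<close>
    have "ws \<in> orbit O2plus (diag_act m) vs"
      using vs ws xs mem orbit_sym orbit_trans by blast
    then obtain g where "g \<in> O2plus_set" "ws = map ((*v) g) vs"
      using mem by (auto simp: orbit)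
    then show "vs = ws"
      using normal_form_unique[OF assms(2), of g vs] vs ws types by auto
  qed
qed

end
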